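(* For every integer $n\geq 0$, $$\sum_{j=0}^\infty \rho_j\, b_6\big(n-j(j+1)/2\big) = \begin{cases} (-1)^k, & \text{if } n=k(3k-2) \text{ for some } k\in\mathbb{Z},\\ 0, & \text{otherwise.}\end{cases}$$
   Context: A partition is called $6$-regular if none of its parts is divisible by $6$; $b_6(n)$ denotes the number of $6$-regular partitions of $n$, with $b_6(0)=1$ and $b_6(n)=0$ for $n<0$. For any integer $k$, $\rho_k:=-2$ if $k\equiv 1\pmod 3$, and $\rho_k:=1$ otherwise. *)

theory Defs
  imports Complex_Main "HOL-Library.Multiset"
begin

definition partition_of :: "nat multiset \<Rightarrow> nat \<Rightarrow> bool" where
  "partition_of P n \<longleftrightarrow> (\<forall>p\<in>#P. p > 0) \<and> \<Sum>\<^sub># P = n"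

definition regular_partition :: "nat \<Rightarrow> nat multiset \<Rightarrow> bool" where
  "regular_partition l P \<longleftrightarrow> (\<forall>p\<in>#P. \<not> l dvd p)"

definition num_regular_partitions :: "nat \<Rightarrow> int \<Rightarrow> nat" where
  "num_regular_partitions l n =
     (if n < 0 then 0 else card {P. partition_of P (nat n) \<and> regular_partition l P})"

abbreviation b6 :: "int \<Rightarrow> nat" where
  "b6 \<equiv> num_regular_partitions 6"

definition rho :: "int \<Rightarrow> int" where
  "rho k = (if k mod 3 = 1 then -2 else 1)"

end

theory Submission
  imports Defs "HOL-Computational_Algebra.Formal_Power_Series"
begin

text \<open>
  With \<open>w\<close> a primitive cube root of unity, \<open>rho j = - (w ^ (j - 1) + w ^ (1 - j))\<close>, so the Jacobi
  triple product with \<open>z = w\<close> turns the sum of \<open>rho j * X ^ (j * (j + 1) / 2)\<close> into the product of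
  \<open>(1 - X ^ i) * (1 - X ^ i + X ^ (2 * i))\<close> over \<open>i \<ge> 1\<close>. Multiplying by the generating function of
  6-regular partitions replaces the factors \<open>1 - X ^ i\<close> by \<open>1 - X ^ (6 * i)\<close>. Since
  \<open>1 - x + x\<^sup>2 = (1 + x ^ 3) / (1 + x)\<close>, Euler's identity between distinct and odd parts leaves the
  factors \<open>1 - X ^ i\<close> with \<open>i\<close> congruent to 1 or 5 modulo 6 besides those. A second triple product, in
  base \<open>X ^ 6\<close>, expands the result as the sum of \<open>(-1) ^ k * X ^ (k * (3 * k - 2))\<close> over all integers \<open>k\<close>.
  Infinite products are replaced throughout by finite ones modulo a power of \<open>X\<close>.
\<close>

unbundle fps_syntax

section \<open>Congruences in a commutative ring\<close>

text \<open>The library congruence \<open>cong\<close> lives in unique Euclidean semirings, and \<open>fps\<close> is not an instance.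
  The modulus is the first argument so that \<open>\<dots>\<close> in calculations denotes the right-hand side.\<close>

definition ring_cong :: "'a::comm_ring_1 \<Rightarrow> 'a \<Rightarrow> 'a \<Rightarrow> bool" where
  "ring_cong m a b \<longleftrightarrow> m dvd a - b"

abbreviation ring_cong_modulo :: "'a::comm_ring_1 \<Rightarrow> 'a \<Rightarrow> 'a \<Rightarrow> bool"
    (\<open>[_ = _] '(modulo _')\<close>)
  where "[a = b] (modulo m) \<equiv> ring_cong m a b"

lemma ring_cong_refl [simp]: "[a = a] (modulo m)"
  by (simp add: ring_cong_def)

lemma ring_cong_sym: "[a = b] (modulo m) \<Longrightarrow> [b = a] (modulo m)"
  unfolding ring_cong_def by (metis dvd_minus_iff minus_diff_eq)

lemma ring_cong_trans [trans]:
  assumes "[a = b] (modulo m)" "[b = c] (modulo m)"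
  shows "[a = c] (modulo m)"
  using dvd_add[OF assms[unfolded ring_cong_def]] by (simp add: ring_cong_def)

lemma ring_cong_add:
  assumes "[a = b] (modulo m)" "[c = d] (modulo m)"
  shows "[a + c = b + d] (modulo m)"
  using dvd_add[OF assms[unfolded ring_cong_def]] by (simp add: ring_cong_def algebra_simps)

lemma ring_cong_mult:
  assumes "[a = b] (modulo m)" "[c = d] (modulo m)"
  shows "[a * c = b * d] (modulo m)"
proof -
  have "m dvd (a - b) * c + b * (c - d)"
    using assms unfolding ring_cong_def by (intro dvd_add dvd_mult dvd_mult2)
  then show ?thesis by (simp add: ring_cong_def algebra_simps)
qed

lemma ring_cong_sum:
  "(\<And>x. x \<in> A \<Longrightarrow> [f x = g x] (modulo m)) \<Longrightarrow> [sum f A = sum g A] (modulo m)"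
  by (induction A rule: infinite_finite_induct) (auto intro: ring_cong_add)

lemma ring_cong_prod:
  "(\<And>x. x \<in> A \<Longrightarrow> [f x = g x] (modulo m)) \<Longrightarrow> [prod f A = prod g A] (modulo m)"
  by (induction A rule: infinite_finite_induct) (auto intro: ring_cong_mult)

lemma ring_cong_dvd_modulus:
  "[a = b] (modulo m) \<Longrightarrow> l dvd m \<Longrightarrow> [a = b] (modulo l)"
  unfolding ring_cong_def by (rule dvd_trans)

lemma ring_cong_prod_one:
  assumes "\<And>x. x \<in> A \<Longrightarrow> [f x = 1] (modulo m)"
  shows "[prod f A = 1] (modulo m)"
  using ring_cong_prod[of A m f "\<lambda>_. 1"] assms by simp

lemma ring_cong_one_minus_power:
  "m \<le> k \<Longrightarrow> [1 - Q ^ k = 1] (modulo Q ^ m)"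
  by (simp add: ring_cong_def le_imp_power_dvd)

subsection \<open>The Jacobi triple product\<close>

lemma choose_two_0 [simp]: "0 choose 2 = 0"
  by (simp add: binomial_eq_0)

lemma choose_two_Suc: "Suc j choose 2 = j + (j choose 2)"
  by (simp add: numeral_2_eq_2)

lemma choose_two_add: "(m + n) choose 2 = (m choose 2) + (n choose 2) + m * n"
  by (induction m) (auto simp: choose_two_Suc)

lemma choose_two_double: "2 * (m choose 2) + m = m * m"
  by (induction m) (auto simp: choose_two_Suc)

text \<open>This is the finite q-Pochhammer symbol \<open>(Q; Q)_n\<close>.\<close>

definition qpoch :: "'a::comm_ring_1 \<Rightarrow> nat \<Rightarrow> 'a" where
  "qpoch Q n = (\<Prod>i<n. 1 - Q ^ Suc i)"

text \<open>Defined by the q-Pascal rule rather than as a quotient, so that it makes sense in any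
  commutative ring.\<close>

fun gauss_binomial :: "'a::comm_ring_1 \<Rightarrow> nat \<Rightarrow> nat \<Rightarrow> 'a" where
  "gauss_binomial Q n 0 = 1"
| "gauss_binomial Q 0 (Suc k) = 0"
| "gauss_binomial Q (Suc n) (Suc k) =
     gauss_binomial Q n k + Q ^ Suc k * gauss_binomial Q n (Suc k)"

lemma gauss_binomial_eq_0: "n < k \<Longrightarrow> gauss_binomial Q n k = 0"
proof (induction n arbitrary: k)
  case 0
  then show ?case by (cases k) auto
next
  case (Suc n)
  then show ?case by (cases k) auto
qed

text \<open>Splitting off the factor \<open>i = 0\<close> leaves the same product with
  \<open>y * Q\<close> for \<open>y\<close>, hence the induction over arbitrary \<open>y\<close>.
  The homogeneous form keeps \<open>x\<close> free for a power of \<open>Q\<close>.\<close>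

theorem q_binomial:
  fixes x y Q :: "'a::comm_ring_1"
  shows "(\<Prod>i<m. x + y * Q ^ i) =
    (\<Sum>j\<le>m. gauss_binomial Q m j * Q ^ (j choose 2) * y ^ j * x ^ (m - j))"
proof (induction m arbitrary: y)
  case 0
  then show ?case by simp
next
  case (Suc m)
  \<comment> \<open>Up to the power of \<open>x\<close>, this is the induction hypothesis' summand
    at \<open>y * Q\<close>: the extra \<open>Q ^ j\<close> turns \<open>j choose 2\<close> into
    \<open>Suc j choose 2\<close>.\<close>
  define t where "t j = gauss_binomial Q m j * Q ^ (Suc j choose 2) * y ^ j" for j
  have t_Suc: "gauss_binomial Q (Suc m) (Suc j) * Q ^ (Suc j choose 2) * y ^ Suc j
      = t (Suc j) + y * t j" for j
    by (simp add: t_def choose_two_Suc algebra_simps power_add)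
  have 1: "(\<Sum>j\<le>m. t j * x ^ (Suc m - j)) = x * (\<Sum>j\<le>m. t j * x ^ (m - j))"
    by (simp add: sum_distrib_left Suc_diff_le mult.left_commute)
  have t0: "t (Suc m) = 0"
    by (simp add: t_def gauss_binomial_eq_0)
  have "(\<Prod>i<Suc m. x + y * Q ^ i) = (x + y) * (\<Prod>i<m. x + (y * Q) * Q ^ i)"
    by (simp add: prod.lessThan_Suc_shift mult.assoc del: prod.lessThan_Suc)
  also have "\<dots> = (x + y) * (\<Sum>j\<le>m. t j * x ^ (m - j))"
    unfolding Suc.IH t_def
    by (simp add: choose_two_Suc power_add power_mult_distrib mult_ac)
  also have "\<dots> = (\<Sum>j\<le>Suc m. t j * x ^ (Suc m - j)) + y * (\<Sum>j\<le>m. t j * x ^ (m - j))"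
    by (simp add: 1[symmetric] t0 distrib_right)
  also have "(\<Sum>j\<le>Suc m. t j * x ^ (Suc m - j))
      = x ^ Suc m + (\<Sum>j\<le>m. t (Suc j) * x ^ (m - j))"
    by (simp add: sum.atMost_Suc_shift t_def choose_two_Suc del: sum.atMost_Suc)
  also have "\<dots> + y * (\<Sum>j\<le>m. t j * x ^ (m - j))
      = x ^ Suc m + (\<Sum>j\<le>m. (t (Suc j) + y * t j) * x ^ (m - j))"
    by (simp add: sum.distrib sum_distrib_left distrib_right mult.assoc)
  also have "\<dots> = (\<Sum>j\<le>Suc m. gauss_binomial Q (Suc m) j * Q ^ (j choose 2) * y ^ j
      * x ^ (Suc m - j))"
    unfolding sum.atMost_Suc_shift t_Suc by simp
  finally show ?case .
qed

text \<open>The quotient formula for Gaussian binomials without division. The q-Pascal rule reduces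
  it to \<open>(1 - Q ^ Suc k) + Q ^ Suc k * (1 - Q ^ (n - k)) = 1 - Q ^ Suc n\<close>.\<close>

lemma qpoch_gauss_binomial:
  "k \<le> n \<Longrightarrow> qpoch Q k * gauss_binomial Q n k = (\<Prod>i<k. 1 - Q ^ (n - i))"
proof (induction Q n k rule: gauss_binomial.induct)
  case (3 Q n k)
  have k: "k \<le> n" using 3 by simp
  have a: "qpoch Q k * gauss_binomial Q n k = (\<Prod>i<k. 1 - Q ^ (n - i))"
    using 3 by simp
  have b: "qpoch Q (Suc k) * gauss_binomial Q n (Suc k) = (\<Prod>i<Suc k. 1 - Q ^ (n - i))"
  proof (cases "Suc k \<le> n")
    case False
    \<comment> \<open>Both sides vanish here: the factor \<open>i = k\<close> on the right is
      \<open>1 - Q ^ 0\<close>.\<close>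
    with k have "n = k" by simp
    then show ?thesis by (simp add: gauss_binomial_eq_0)
  qed (use 3 in simp)
  have "qpoch Q (Suc k) * gauss_binomial Q (Suc n) (Suc k)
     = (1 - Q ^ Suc k) * (qpoch Q k * gauss_binomial Q n k)
       + Q ^ Suc k * (qpoch Q (Suc k) * gauss_binomial Q n (Suc k))"
    by (simp add: qpoch_def algebra_simps)
  also have "\<dots> = (\<Prod>i<k. 1 - Q ^ (n - i)) * (1 - Q ^ Suc k * Q ^ (n - k))"
    unfolding a b by (simp add: algebra_simps)
  also have "Q ^ Suc k * Q ^ (n - k) = Q ^ Suc n"
    using k by (simp add: mult.assoc flip: power_add)
  finally show ?case
    by (simp add: prod.lessThan_Suc_shift mult.commute del: prod.lessThan_Suc)
qed (auto simp: qpoch_def)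

lemma qpoch_split:
  "k \<le> n \<Longrightarrow> qpoch Q n = qpoch Q (n - k) * (\<Prod>i<k. 1 - Q ^ (n - i))"
proof (induction k)
  case (Suc k)
  then have "n - k = Suc (n - Suc k)" by simp
  then have "qpoch Q (n - k) = qpoch Q (n - Suc k) * (1 - Q ^ (n - k))"
    by (simp add: qpoch_def)
  with Suc show ?case by (simp add: mult_ac)
qed simp

lemma qpoch_nonzero:
  fixes Q :: "'a::idom"
  assumes "\<And>i. i > 0 \<Longrightarrow> Q ^ i \<noteq> 1"
  shows "qpoch Q n \<noteq> 0"
  using assms by (auto simp: qpoch_def simp del: power_Suc)

text \<open>Both sides become \<open>qpoch Q n\<close> after multiplication by the same product,
  which is nonzero and so can be cancelled in a domain.\<close>

lemma gauss_binomial_symmetric: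
  fixes Q :: "'a::idom"
  assumes Q: "\<And>i. i > 0 \<Longrightarrow> Q ^ i \<noteq> 1" and "k \<le> n"
  shows "gauss_binomial Q n (n - k) = gauss_binomial Q n k"
proof -
  have *: "qpoch Q (n - j) * qpoch Q j * gauss_binomial Q n j = qpoch Q n" if "j \<le> n" for j
    using qpoch_gauss_binomial[OF that, of Q] qpoch_split[OF that, of Q] by (simp add: mult.assoc)
  have "qpoch Q (n - k) * qpoch Q k * gauss_binomial Q n (n - k)
      = qpoch Q (n - k) * qpoch Q k * gauss_binomial Q n k"
    using *[of k] *[of "n - k"] \<open>k \<le> n\<close> by (simp add: mult_ac)
  then show ?thesis using qpoch_nonzero[OF Q] by simp
qed

text \<open>By symmetry and the quotient formula the left-hand side is a product of factors
  \<open>1 - Q ^ e\<close>, all with \<open>e > n - k\<close>.\<close>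

lemma qpoch_mult_gauss_binomial_cong:
  fixes Q :: "'a::idom"
  assumes Q: "\<And>i. i > 0 \<Longrightarrow> Q ^ i \<noteq> 1" and k: "k \<le> n"
    and j: "j = n + k \<or> j = n - k"
  shows "[qpoch Q n * gauss_binomial Q (2 * n) j = 1] (modulo Q ^ Suc (n - k))"
proof -
  have "gauss_binomial Q (2 * n) j = gauss_binomial Q (2 * n) (n - k)"
    using gauss_binomial_symmetric[OF Q, of "n + k" "2 * n"] j k by auto
  then have "qpoch Q n * gauss_binomial Q (2 * n) j
      = (\<Prod>i<k. 1 - Q ^ (n - i)) * (\<Prod>i<n - k. 1 - Q ^ (2 * n - i))"
    using qpoch_split[OF k, of Q] qpoch_gauss_binomial[of "n - k" "2 * n" Q]
    by (simp add: mult_ac)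
  also have "[\<dots> = 1 * 1] (modulo Q ^ Suc (n - k))"
    by (intro ring_cong_mult ring_cong_prod_one ring_cong_one_minus_power) (use k in auto)
  finally show ?thesis by simp
qed

text \<open>This is \<open>q_binomial\<close> with \<open>x = Q ^ n\<close> and \<open>y = a\<close>, multiplied by \<open>b ^ n\<close> to clear the negative powers of
  \<open>a\<close>, since \<open>b * (Q ^ n + a * Q ^ i) = Q ^ Suc i * (1 + b * Q ^ (n - Suc i))\<close> for \<open>i < n\<close>.\<close>

theorem finite_triple_product:
  fixes Q a b :: "'a::idom"
  assumes Q0: "Q \<noteq> 0" and ab: "a * b = Q"
  shows "(\<Prod>i<n. (1 + a * Q ^ i) * (1 + b * Q ^ i)) =
    (\<Sum>k\<le>n. gauss_binomial Q (2 * n) (n + k) * (Q ^ (k choose 2) * a ^ k)) +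
    (\<Sum>k=1..n. gauss_binomial Q (2 * n) (n - k) * (Q ^ (k choose 2) * b ^ k))"
    (is "?P = ?S")
proof -
  \<comment> \<open>The power of \<open>Q\<close> that factors out of the whole product:
    \<open>n choose 2\<close> from the \<open>Q ^ i\<close>, \<open>n * n\<close> from the upper
    half of the indices, and \<open>n\<close> from the single \<open>Q\<close> in each lower
    factor.\<close>
  define c where "c = Q ^ ((n choose 2) + n * n + n)"
  define G where "G = gauss_binomial Q (2 * n)"
  have prod_Q: "(\<Prod>i<n. Q ^ i) = Q ^ (n choose 2)" for n
    by (induction n) (auto simp: choose_two_Suc power_add)
  have prod_add: "(\<Prod>i<n + m. f i) = (\<Prod>i<n. f i) * (\<Prod>i<m. f (n + i))" for m and f :: "nat \<Rightarrow> 'a"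
    by (induction m) (auto simp: mult.assoc)
  have "c * ?P = b ^ n * (\<Prod>i<2*n. Q ^ n + a * Q ^ i)"
  proof -
    have "(\<Prod>i<2*n. Q ^ n + a * Q ^ i)
        = (\<Prod>i<n. Q ^ n + a * Q ^ i) * (\<Prod>i<n. Q ^ n + a * Q ^ (n + i))"
      unfolding mult_2 by (rule prod_add)
    also have "(\<Prod>i<n. Q ^ n + a * Q ^ (n + i)) = Q ^ (n * n) * (\<Prod>i<n. 1 + a * Q ^ i)"
    proof -
      have "Q ^ n + a * Q ^ (n + i) = Q ^ n * (1 + a * Q ^ i)" for i
        by (simp add: algebra_simps power_add)
      then show ?thesis by (simp add: prod.distrib power_mult)
    qed
    also have "b ^ n * ((\<Prod>i<n. Q ^ n + a * Q ^ i) * \<dots>)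
        = (\<Prod>i<n. b * (Q ^ n + a * Q ^ i)) * Q ^ (n * n) * (\<Prod>i<n. 1 + a * Q ^ i)"
      by (simp add: prod.distrib mult_ac)
    also have "(\<Prod>i<n. b * (Q ^ n + a * Q ^ i))
        = (\<Prod>i<n. Q ^ i * (Q * (1 + b * Q ^ (n - Suc i))))"
    proof (rule prod.cong)
      fix i assume "i \<in> {..<n}"
      then have "n = i + Suc (n - Suc i)" by simp
      then have "Q ^ n = Q ^ i * (Q * Q ^ (n - Suc i))"
        by (metis power_Suc power_add)
      then show "b * (Q ^ n + a * Q ^ i) = Q ^ i * (Q * (1 + b * Q ^ (n - Suc i)))"
        by (simp add: algebra_simps flip: ab)
    qed simp
    also have "\<dots> = Q ^ (n choose 2) * Q ^ n * (\<Prod>i<n. 1 + b * Q ^ i)"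
      by (simp add: prod.distrib prod_Q mult.assoc prod.nat_diff_reindex[of "\<lambda>i. 1 + b * Q ^ i"])
    finally show ?thesis
      by (simp add: c_def prod.distrib power_add mult_ac)
  qed
  also have "\<dots> = (\<Sum>j\<le>2*n. b ^ n * (G j * Q ^ (j choose 2) * a ^ j * (Q ^ n) ^ (2 * n - j)))"
    unfolding q_binomial by (simp add: sum_distrib_left G_def)
  \<comment> \<open>The summation is recentred at \<open>j = n\<close>: indices above leave powers
    of \<open>a\<close>, indices below leave powers of \<open>b\<close>.\<close>
  also have "\<dots> = (\<Sum>j\<in>(\<lambda>k. n + k) ` {..n} \<union> (\<lambda>k. n - k) ` {1..n}.
      b ^ n * (G j * Q ^ (j choose 2) * a ^ j * (Q ^ n) ^ (2 * n - j)))"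
    (is "_ = sum ?t _")
  proof (rule sum.cong)
    show "{..2*n} = (\<lambda>k. n + k) ` {..n} \<union> (\<lambda>k. n - k) ` {1..n}"
    proof (intro equalityI subsetI)
      fix j assume "j \<in> {..2*n}"
      then show "j \<in> (\<lambda>k. n + k) ` {..n} \<union> (\<lambda>k. n - k) ` {1..n}"
        by (cases "n \<le> j") (auto intro: image_eqI[of _ _ "j - n"] image_eqI[of _ _ "n - j"])
    qed auto
  qed simp
  also have "\<dots> = (\<Sum>k\<le>n. b ^ n * (G (n + k) * Q ^ ((n + k) choose 2) * a ^ (n + k)
        * (Q ^ n) ^ (2 * n - (n + k))))
      + (\<Sum>k=1..n. b ^ n * (G (n - k) * Q ^ ((n - k) choose 2) * a ^ (n - k)
        * (Q ^ n) ^ (2 * n - (n - k))))"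
  proof (subst sum.union_disjoint)
    have "inj_on (\<lambda>k. n + k) {..n}" "inj_on (\<lambda>k. n - k) {1..n}"
      by (auto intro!: inj_onI)
    then show "sum ?t ((\<lambda>k. n + k) ` {..n}) + sum ?t ((\<lambda>k. n - k) ` {1..n}) =
        (\<Sum>k\<le>n. ?t (n + k)) + (\<Sum>k=1..n. ?t (n - k))"
      by (simp only: sum.reindex o_def)
  qed auto
  also have "\<dots> = (\<Sum>k\<le>n. c * (G (n + k) * (Q ^ (k choose 2) * a ^ k)))
      + (\<Sum>k=1..n. c * (G (n - k) * (Q ^ (k choose 2) * b ^ k)))"
  proof (intro arg_cong2[where f = "(+)"] sum.cong refl)
    fix k assume "k \<in> {..n}"
    \<comment> \<open>All of \<open>b ^ n\<close> pairs with \<open>n\<close> of the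
      \<open>n + k\<close> factors \<open>a\<close>, leaving \<open>a ^ k\<close>.\<close>
    then obtain d where n: "n = k + d" by (auto simp: le_iff_add)
    have e: "((n + k) choose 2) + n * d + n = (n choose 2) + n * n + n + (k choose 2)"
      by (simp add: n choose_two_add algebra_simps)
    have "b ^ n * (G (n + k) * Q ^ ((n + k) choose 2) * a ^ (n + k) * (Q ^ n) ^ (2 * n - (n + k)))
        = G (n + k) * a ^ k * (Q ^ ((n + k) choose 2) * (Q ^ n) ^ d * (a * b) ^ n)"
      by (simp add: n power_add power_mult_distrib mult_ac)
    also have "Q ^ ((n + k) choose 2) * (Q ^ n) ^ d * (a * b) ^ n = c * Q ^ (k choose 2)"
      unfolding c_def ab power_mult[symmetric] power_add[symmetric] e by simp
    finally show "b ^ n * (G (n + k) * Q ^ ((n + k) choose 2) * a ^ (n + k) * (Q ^ n) ^ (2 * n - (n + k)))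
        = c * (G (n + k) * (Q ^ (k choose 2) * a ^ k))"
      by (simp add: mult_ac)
  next
    fix k assume "k \<in> {1..n}"
    \<comment> \<open>Only \<open>d = n - k\<close> factors \<open>a\<close> are available for
      pairing, so \<open>b ^ k\<close> is left.\<close>
    then obtain d where n: "n = k + d" by (auto simp: le_iff_add)
    have e: "(d choose 2) + n * (n + k) + d = (n choose 2) + n * n + n + (k choose 2)"
      using choose_two_double[of k] by (simp add: n choose_two_add algebra_simps)
    have "b ^ n * (G (n - k) * Q ^ ((n - k) choose 2) * a ^ (n - k) * (Q ^ n) ^ (2 * n - (n - k)))
        = G (n - k) * b ^ k * (Q ^ (d choose 2) * (Q ^ n) ^ (n + k) * (a * b) ^ d)"
    proof -
      have "n - k = d" "2 * n - d = n + k" "b ^ n = b ^ k * b ^ d"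
        by (simp_all add: n power_add)
      then show ?thesis by (simp add: power_mult_distrib mult_ac)
    qed
    also have "Q ^ (d choose 2) * (Q ^ n) ^ (n + k) * (a * b) ^ d = c * Q ^ (k choose 2)"
      unfolding c_def ab power_mult[symmetric] power_add[symmetric] e by simp
    finally show "b ^ n * (G (n - k) * Q ^ ((n - k) choose 2) * a ^ (n - k) * (Q ^ n) ^ (2 * n - (n - k)))
        = c * (G (n - k) * (Q ^ (k choose 2) * b ^ k))"
      by (simp add: mult_ac)
  qed
  also have "\<dots> = c * ?S"
    by (simp add: G_def sum_distrib_left distrib_left)
  finally show ?thesis using Q0 by (simp add: c_def)
qed

text \<open>The \<open>k\<close>-th Gaussian binomial times \<open>qpoch Q n\<close> is 1 only modulo \<open>Q ^ Suc (n - k)\<close>; the missing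
  powers are supplied by the factor \<open>Q ^ (k choose 2)\<close>.\<close>

theorem triple_product_cong:
  fixes Q a b :: "'a::idom"
  assumes Q0: "Q \<noteq> 0" and Q1: "\<And>i. i > 0 \<Longrightarrow> Q ^ i \<noteq> 1" and ab: "a * b = Q"
  shows "[qpoch Q n * (\<Prod>i<n. (1 + a * Q ^ i) * (1 + b * Q ^ i)) =
    (\<Sum>k\<le>n. Q ^ (k choose 2) * a ^ k) + (\<Sum>k=1..n. Q ^ (k choose 2) * b ^ k)]
    (modulo Q ^ n)"
proof -
  have *: "[qpoch Q n * (gauss_binomial Q (2 * n) j * (Q ^ (k choose 2) * z))
      = Q ^ (k choose 2) * z] (modulo Q ^ n)" if "k \<le> n" "j = n + k \<or> j = n - k" for j k z
  proof -
    have "k \<le> Suc (k choose 2)"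
      by (cases k) (auto simp: choose_two_Suc)
    then have "Q ^ n dvd Q ^ Suc (n - k) * Q ^ (k choose 2)"
      using that(1) unfolding power_add[symmetric] by (intro le_imp_power_dvd) simp
    also have "\<dots> dvd (qpoch Q n * gauss_binomial Q (2 * n) j - 1) * (Q ^ (k choose 2) * z)"
      using qpoch_mult_gauss_binomial_cong[OF Q1 that]
      unfolding ring_cong_def by (intro mult_dvd_mono) auto
    finally show ?thesis
      by (simp add: ring_cong_def algebra_simps)
  qed
  show ?thesis
    unfolding finite_triple_product[OF Q0 ab] distrib_left[of "qpoch Q n"] sum_distrib_left
    by (intro ring_cong_add ring_cong_sum *) auto
qed

section \<open>Power series modulo powers of \<open>fps_X\<close>\<close>

lemma fps_X_power_dvd_iff:
  fixes f :: "'a::comm_ring_1 fps"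
  shows "fps_X ^ n dvd f \<longleftrightarrow> (\<forall>i<n. f $ i = 0)"
proof
  assume "\<forall>i<n. f $ i = 0"
  then have "f = fps_X ^ n * fps_shift n f"
    by (auto simp: fps_eq_iff fps_X_power_mult_nth)
  then show "fps_X ^ n dvd f" by (rule dvdI)
qed (auto simp: fps_X_power_mult_nth elim!: dvdE)

lemma ring_cong_fps_X_power:
  fixes f g :: "'a::comm_ring_1 fps"
  shows "[f = g] (modulo fps_X ^ n) \<longleftrightarrow> (\<forall>i<n. f $ i = g $ i)"
  by (simp add: ring_cong_def fps_X_power_dvd_iff)

lemma ring_cong_unit_cancel:
  assumes "[s * u = s * v] (modulo m)" "s dvd 1"
  shows "[u = v] (modulo m)"
proof -
  obtain t where t: "1 = s * t" using assms(2) by (rule dvdE)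
  have "[t * (s * u) = t * (s * v)] (modulo m)"
    by (rule ring_cong_mult) (use assms(1) in auto)
  moreover have "t * (s * z) = z" for z
    using t by (metis mult.assoc mult.commute mult_1)
  ultimately show ?thesis by simp
qed

lemma fps_X_power_power_neq_one:
  assumes "m > 0" "i > 0"
  shows "(fps_X ^ m :: 'a::comm_ring_1 fps) ^ i \<noteq> 1"
proof
  assume "(fps_X ^ m :: 'a fps) ^ i = 1"
  then have "((fps_X ^ m :: 'a fps) ^ i) $ 0 = 1" by simp
  with assms show False by (simp flip: power_mult)
qed

text \<open>The constant coefficient is 1, so these products may be cancelled from
  congruences.\<close>

lemma qpoch_fps_X_power_unit:
  assumes "m > 0"
  shows "qpoch (fps_X ^ m :: 'a::field fps) n dvd 1"
proof -
  have "qpoch (fps_X ^ m :: 'a fps) n $ 0 = 1"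
  proof (induction n)
    case (Suc n)
    have "((fps_X ^ m :: 'a fps) ^ Suc n) $ 0 = 0"
      using assms unfolding power_mult[symmetric] by simp
    with Suc show ?case by (simp add: qpoch_def del: power_Suc)
  qed (simp add: qpoch_def)
  then show ?thesis by simp
qed

lemma qpoch_cong: "n \<le> m \<Longrightarrow> [qpoch Q m = qpoch Q n] (modulo Q ^ n)"
proof (induction rule: dec_induct)
  case (step m)
  have "[qpoch Q m * (1 - Q ^ Suc m) = qpoch Q n * 1] (modulo Q ^ n)"
    by (intro ring_cong_mult step.IH ring_cong_one_minus_power) (use step.hyps in simp)
  then show ?case by (simp add: qpoch_def)
qed simp

subsection \<open>Euler products of power series\<close>

lemma qpoch_double:
  "qpoch Q (2 * n) = qpoch (Q ^ 2) n * (\<Prod>i<n. 1 - Q ^ (2 * i + 1))"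
  by (induction n) (auto simp: qpoch_def power_mult power2_eq_square algebra_simps)

text \<open>From \<open>(1 - x) * (1 + x) = 1 - x ^ 2\<close>, multiplying by
  \<open>qpoch Q n\<close> turns the first product into \<open>qpoch (Q ^ 2) n\<close>. The odd
  factors complete this to \<open>qpoch Q (2 * n)\<close>, which agrees with the unit
  \<open>qpoch Q n\<close> modulo \<open>Q ^ n\<close>.\<close>

lemma euler_odd_distinct:
  fixes Q :: "'a::field fps"
  assumes Q: "Q = fps_X ^ m" "m > 0"
  shows "[(\<Prod>i<n. 1 + Q ^ Suc i) * (\<Prod>i<n. 1 - Q ^ (2 * i + 1)) = 1] (modulo Q ^ n)"
proof (rule ring_cong_unit_cancel[where s = "qpoch Q n"])
  have "qpoch Q n * (\<Prod>i<n. 1 + Q ^ Suc i) = qpoch (Q ^ 2) n"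
    unfolding qpoch_def prod.distrib[symmetric]
    by (intro prod.cong refl) (simp add: algebra_simps power2_eq_square power_mult_distrib)
  then have "qpoch Q n * ((\<Prod>i<n. 1 + Q ^ Suc i) * (\<Prod>i<n. 1 - Q ^ (2 * i + 1))) = qpoch Q (2 * n)"
    by (simp add: qpoch_double mult.assoc[symmetric])
  then show "[qpoch Q n * ((\<Prod>i<n. 1 + Q ^ Suc i) * (\<Prod>i<n. 1 - Q ^ (2 * i + 1)))
      = qpoch Q n * 1] (modulo Q ^ n)"
    using qpoch_cong[of n "2 * n" Q] by simp
qed (use Q in \<open>simp add: qpoch_fps_X_power_unit del: fps_is_unit_iff\<close>)

lemma cyclotomic_product_cong:
  fixes X :: "'a::field fps"
  defines "X \<equiv> fps_X"
  shows "[(\<Prod>i<n. 1 - X ^ Suc i + (X ^ Suc i)\<^sup>2)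
      = (\<Prod>i<n. (1 - X ^ (6 * i + 1)) * (1 - X ^ (6 * i + 5)))] (modulo X ^ n)"
    (is "[?R = ?D] (modulo _)")
proof -
  \<comment> \<open>By Euler's identity \<open>U\<close> and \<open>V\<close> are inverse to each
    other up to truncation, both in base \<open>X\<close> and in base \<open>X ^ 3\<close>.\<close>
  define U where "U Q = (\<Prod>i<n. 1 + Q ^ Suc i)" for Q :: "'a fps"
  define V where "V Q k = (\<Prod>i<k. 1 - Q ^ (2 * i + 1))" for Q :: "'a fps" and k
  have RU: "?R * U X = U (X ^ 3)"
  proof -
    have "(1 - x + x\<^sup>2) * (1 + x) = 1 + x ^ 3" for x :: "'a fps"
      by (simp add: algebra_simps power2_eq_square power3_eq_cube)
    moreover have "(X ^ 3) ^ k = (X ^ k) ^ 3" for k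
      by (simp only: mult.commute flip: power_mult)
    ultimately show ?thesis
      unfolding U_def prod.distrib[symmetric] by (intro prod.cong refl) (simp only:)
  qed
  \<comment> \<open>The odd exponents below \<open>6 * n\<close> are sorted by residue modulo 6;
    those congruent to 3 are the triples of odd numbers. Length \<open>3 * n\<close> makes this an
    exact equation.\<close>
  have V: "V X (3 * n) = ?D * V (X ^ 3) n"
  proof -
    have *: "(\<Prod>i<3 * n. f i) = (\<Prod>i<n. f (3 * i) * f (3 * i + 1) * f (3 * i + 2))"
      for f :: "nat \<Rightarrow> 'a fps"
    proof (induction n)
      case (Suc n)
      have "3 * Suc n = Suc (Suc (Suc (3 * n)))" by simp
      then show ?case
        unfolding \<open>3 * Suc n = _\<close> prod.lessThan_Suc Suc.IH by (simp add: mult_ac)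
    qed simp
    have exps: "2 * (3 * i) + 1 = 6 * i + 1" "2 * (3 * i + 1) + 1 = 3 * (2 * i + 1)"
      "2 * (3 * i + 2) + 1 = 6 * i + 5" for i :: nat
      by simp_all
    show ?thesis
      unfolding V_def * exps power_mult[of X 3] prod.distrib by (simp only: mult_ac)
  qed
  have V_cong: "[V X k = V X n] (modulo X ^ n)" if "n \<le> k" for k
    using that
  proof (induction rule: dec_induct)
    case (step k)
    have "[V X k * (1 - X ^ (2 * k + 1)) = V X n * 1] (modulo X ^ n)"
      by (intro ring_cong_mult step.IH ring_cong_one_minus_power) (use step.hyps in simp)
    then show ?case by (simp add: V_def)
  qed simp
  have UV: "[U X * V X (3 * n) = 1] (modulo X ^ n)"
  proof -
    have "[U X * V X (3 * n) = U X * V X n] (modulo X ^ n)"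
      by (intro ring_cong_mult V_cong) auto
    also have "[U X * V X n = 1] (modulo X ^ n)"
      unfolding U_def V_def using euler_odd_distinct[of X 1] by (simp add: X_def)
    finally show ?thesis .
  qed
  have UV3: "[U (X ^ 3) * V (X ^ 3) n = 1] (modulo X ^ n)"
  proof (rule ring_cong_dvd_modulus)
    show "[U (X ^ 3) * V (X ^ 3) n = 1] (modulo (X ^ 3) ^ n)"
      unfolding U_def V_def by (rule euler_odd_distinct[of _ 3]) (auto simp: X_def)
    show "X ^ n dvd (X ^ 3) ^ n"
      unfolding power_mult[symmetric] by (rule le_imp_power_dvd) simp
  qed
  have "[?R * 1 = ?R * (U X * V X (3 * n))] (modulo X ^ n)"
    by (intro ring_cong_mult ring_cong_sym[OF UV]) auto
  also have "?R * (U X * V X (3 * n)) = ?D * (U (X ^ 3) * V (X ^ 3) n)"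
    unfolding V RU[symmetric] by (simp only: mult_ac)
  also have "[\<dots> = ?D * 1] (modulo X ^ n)"
    by (intro ring_cong_mult UV3) auto
  finally show ?thesis by simp
qed

subsection \<open>Generating functions of partitions\<close>

lemma partition_of_add_mset:
  "partition_of (add_mset i P) n \<longleftrightarrow> 0 < i \<and> i \<le> n \<and> partition_of P (n - i)"
  by (auto simp: partition_of_def)

lemma finite_partition_of: "finite {P. partition_of P n}"
proof (induction n rule: less_induct)
  case (less n)
  have "{P. partition_of P n} \<subseteq>
      insert {#} (\<Union>i\<in>{1..n}. add_mset i ` {P. partition_of P (n - i)})"
  proof
    fix P assume "P \<in> {P. partition_of P n}"
    then show "P \<in> insert {#} (\<Union>i\<in>{1..n}. add_mset i ` {P. partition_of P (n - i)})"
      by (cases P) (auto simp: partition_of_add_mset)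
  qed
  moreover have "finite \<dots>" using less by auto
  ultimately show ?case by (rule finite_subset)
qed

lemma partition_of_part_le: "partition_of P n \<Longrightarrow> p \<in># P \<Longrightarrow> p \<le> n"
  by (auto simp: partition_of_def sum_mset.remove)

text \<open>Arbitrary sets of allowed parts permit induction that adds one part size at a
  time.\<close>

definition partition_gf :: "nat set \<Rightarrow> 'a::comm_ring_1 fps" where
  "partition_gf A = Abs_fps (\<lambda>n. of_nat (card {P. partition_of P n \<and> set_mset P \<subseteq> A}))"

text \<open>A partition either avoids \<open>i\<close> or arises in exactly one way by adding one
  copy of \<open>i\<close> to a smaller partition.\<close>

lemma partition_gf_insert:
  assumes "i \<notin> A" "i > 0"
  shows "partition_gf (insert i A) * (1 - fps_X ^ i) = partition_gf A"
proof (rule fps_ext)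
  fix n
  let ?p = "\<lambda>A n. {P. partition_of P n \<and> set_mset P \<subseteq> A}"
  have fin: "finite (?p A n)" for A n
    using finite_partition_of[of n] by (rule rev_finite_subset) auto
  have split: "?p (insert i A) n = ?p A n \<union>
      (if i \<le> n then add_mset i ` ?p (insert i A) (n - i) else {})" (is "_ = _ \<union> ?I")
  proof (intro equalityI subsetI)
    fix P assume P: "P \<in> ?p (insert i A) n"
    show "P \<in> ?p A n \<union> ?I"
    proof (cases "i \<in># P")
      case True
      then obtain P' where "P = add_mset i P'" by (metis insert_DiffM)
      with P show ?thesis by (auto simp: partition_of_add_mset)
    qed (use P in auto)
  qed (use \<open>i > 0\<close> in \<open>auto simp: partition_of_add_mset split: if_splits\<close>)
  have "card (?p (insert i A) n) = card (?p A n) + card ?I"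
    unfolding split by (rule card_Un_disjoint) (use fin assms in auto)
  also have "card ?I = (if i \<le> n then card (?p (insert i A) (n - i)) else 0)"
    by (auto intro!: card_image inj_onI)
  finally show "(partition_gf (insert i A) * (1 - fps_X ^ i)) $ n = (partition_gf A :: 'a fps) $ n"
    by (simp add: partition_gf_def algebra_simps fps_X_power_mult_nth)
qed

lemma partition_gf_mult_prod:
  assumes "finite A" "0 \<notin> A"
  shows "partition_gf A * (\<Prod>i\<in>A. 1 - fps_X ^ i) = 1"
  using assms
proof (induction A rule: finite_induct)
  case empty
  have "{P. partition_of P n \<and> set_mset P \<subseteq> {}} = (if n = 0 then {{#}} else {})" for n
    by (auto simp: partition_of_def)
  then show ?case by (auto simp: partition_gf_def fps_eq_iff)
next
  case (insert i A)
  then have "partition_gf (insert i A) * (1 - fps_X ^ i) * (\<Prod>i\<in>A. 1 - fps_X ^ i) = (1 :: 'a fps)"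
    by (subst partition_gf_insert) auto
  with insert show ?case by (simp add: mult.assoc)
qed

lemma regular_partition_gf_cong:
  fixes X :: "'a::comm_ring_1 fps"
  defines "X \<equiv> fps_X"
  assumes l: "l > 0"
  shows "[Abs_fps (\<lambda>n. of_nat (num_regular_partitions l (int n))) * qpoch X n = qpoch (X ^ l) n]
    (modulo X ^ n)" (is "[?B * _ = _] (modulo _)")
proof -
  \<comment> \<open>Parts below \<open>n\<close> would suffice for the coefficients; with the bound
    \<open>l * n\<close> the omitted multiples of \<open>l\<close> are \<open>l * 1\<close> to
    \<open>l * n\<close>, which give exactly \<open>qpoch (X ^ l) n\<close>.\<close>
  define A where "A = {i\<in>{1..l * n}. \<not> l dvd i}"
  have le: "n \<le> l * n" using l by simp
  have "?B $ i = partition_gf A $ i" if "i < n" for i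
  proof -
    have "{P. partition_of P i \<and> regular_partition l P} = {P. partition_of P i \<and> set_mset P \<subseteq> A}"
    proof (intro Collect_cong conj_cong refl)
      fix P assume P: "partition_of P i"
      have "p \<in> {1..l * n}" if p: "p \<in># P" for p
      proof -
        have "p \<le> l * n"
          using partition_of_part_le[OF P p] \<open>i < n\<close> le by linarith
        moreover have "p > 0"
          using P p by (auto simp: partition_of_def)
        ultimately show ?thesis by simp
      qed
      then show "regular_partition l P \<longleftrightarrow> set_mset P \<subseteq> A"
        by (auto simp: A_def regular_partition_def)
    qed
    then show ?thesis
      by (simp add: num_regular_partitions_def partition_gf_def)
  qed
  then have "[?B = partition_gf A] (modulo X ^ n)"
    by (simp add: X_def ring_cong_fps_X_power)
  then have "[?B * qpoch X n = partition_gf A * qpoch X (l * n)] (modulo X ^ n)"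
    by (intro ring_cong_mult ring_cong_sym[OF qpoch_cong] le)
  also have "qpoch X (l * n) = (\<Prod>i\<in>A. 1 - X ^ i) * qpoch (X ^ l) n"
  proof -
    have "qpoch X (l * n) = (\<Prod>i\<in>{1..l * n}. 1 - X ^ i)"
      unfolding qpoch_def by (rule prod.reindex_bij_witness[of _ "\<lambda>i. i - 1" Suc]) auto
    also have "{1..l * n} = A \<union> (\<lambda>i. l * Suc i) ` {..<n}"
    proof (intro equalityI subsetI)
      fix i assume i: "i \<in> {1..l * n}"
      show "i \<in> A \<union> (\<lambda>i. l * Suc i) ` {..<n}"
      proof (cases "l dvd i")
        case True
        then obtain k where k: "i = l * k" by (rule dvdE)
        with i l have "k \<noteq> 0" "k \<le> n" by auto
        then have "i = l * Suc (k - 1)" "k - 1 < n" using k by auto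
        then show ?thesis by blast
      qed (use i in \<open>simp add: A_def\<close>)
    next
      fix i assume "i \<in> A \<union> (\<lambda>i. l * Suc i) ` {..<n}"
      then consider "i \<in> A" | k where "k < n" "i = l * Suc k" by auto
      then show "i \<in> {1..l * n}"
      proof cases
        case 2
        then have "l * Suc k \<le> l * n" by (intro mult_le_mono2) simp
        with 2 l show ?thesis by simp
      qed (simp add: A_def)
    qed
    also have "(\<Prod>i\<in>\<dots>. 1 - X ^ i)
        = (\<Prod>i\<in>A. 1 - X ^ i) * (\<Prod>i\<in>(\<lambda>i. l * Suc i) ` {..<n}. 1 - X ^ i)"
      by (rule prod.union_disjoint) (auto simp: A_def)
    also have "(\<Prod>i\<in>(\<lambda>i. l * Suc i) ` {..<n}. 1 - X ^ i) = qpoch (X ^ l) n"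
      unfolding qpoch_def power_mult[symmetric] using l by (subst prod.reindex) (auto simp: inj_on_def)
    finally show ?thesis .
  qed
  also have "partition_gf A * \<dots> = qpoch (X ^ l) n"
  proof -
    have "partition_gf A * (\<Prod>i\<in>A. 1 - X ^ i) = 1"
      unfolding X_def by (rule partition_gf_mult_prod) (auto simp: A_def)
    then show ?thesis by (simp flip: mult.assoc)
  qed
  finally show ?thesis .
qed

subsection \<open>The two theta series\<close>

lemma primitive_cube_root_of_unity_exists: "\<exists>w::complex. w\<^sup>2 + w + 1 = 0"
  by (rule exI[of _ "Complex (-1/2) (sqrt 3 / 2)"])
    (simp add: complex_eq_iff power2_eq_square)

text \<open>The two powers are the coefficients from the two halves of the triple product. The
  factor \<open>- w\<^sup>2\<close> is the inverse of \<open>- w = 1 + w\<^sup>2\<close>, the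
  constant factor of that product.\<close>

lemma rho_eq_cube_roots:
  fixes w :: complex
  assumes w: "w\<^sup>2 + w + 1 = 0"
  shows "- w\<^sup>2 * (w ^ j + w ^ (2 * Suc j)) = of_int (rho (int j))"
proof -
  have w3: "w ^ 3 = 1"
  proof -
    have "w ^ 3 - 1 = (w - 1) * (w\<^sup>2 + w + 1)"
      by (simp add: algebra_simps power2_eq_square power3_eq_cube)
    with w show ?thesis by simp
  qed
  have red: "w ^ k = w ^ (k mod 3)" for k
    by (metis w3 mult_div_mod_eq power_add power_mult power_one mult_1)
  have "- w\<^sup>2 * (w ^ j + w ^ (2 * Suc j)) = - (w ^ (j + 2) + w ^ (2 * j + 4))"
    by (simp add: algebra_simps eval_nat_numeral flip: power_Suc power_add)
  also have "\<dots> = - (w ^ ((j + 2) mod 3) + w ^ ((2 * j + 4) mod 3))"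
    by (metis red)
  also have "\<dots> = of_int (rho (int j))"
  proof -
    consider "j mod 3 = 0" | "j mod 3 = 1" | "j mod 3 = 2" by linarith
    then show ?thesis
    proof cases
      case 1
      then have "(j + 2) mod 3 = 2" "(2 * j + 4) mod 3 = 1" "int j mod 3 \<noteq> 1" by presburger+
      with w show ?thesis by (simp add: rho_def add_eq_0_iff2 algebra_simps)
    next
      case 2
      then have "(j + 2) mod 3 = 0" "(2 * j + 4) mod 3 = 0" "int j mod 3 = 1" by presburger+
      then show ?thesis by (simp add: rho_def)
    next
      case 3
      then have "(j + 2) mod 3 = 1" "(2 * j + 4) mod 3 = 2" "int j mod 3 \<noteq> 1" by presburger+
      with w show ?thesis by (simp add: rho_def add_eq_0_iff2 algebra_simps)
    qed
  qed
  finally show ?thesis .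
qed

lemma rho_theta_cong:
  fixes X :: "complex fps"
  defines "X \<equiv> fps_X"
  shows "[(\<Sum>j\<le>n. of_int (rho (int j)) * X ^ (Suc j choose 2))
      = qpoch X n * (\<Prod>i<n. 1 - X ^ Suc i + (X ^ Suc i)\<^sup>2)] (modulo X ^ n)"
proof -
  obtain w :: complex where w: "w\<^sup>2 + w + 1 = 0"
    using primitive_cube_root_of_unity_exists by blast
  define c where "c = fps_const w"
  have c: "c\<^sup>2 + c + 1 = 0"
    using arg_cong[OF w, of fps_const] unfolding c_def
    by (simp flip: fps_const_add fps_const_power)
  have c3: "c * c\<^sup>2 = 1"
  proof -
    have "c * c\<^sup>2 - 1 = (c - 1) * (c\<^sup>2 + c + 1)"
      by (simp add: algebra_simps power2_eq_square)
    with c show ?thesis by simp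
  qed
  have c_pow: "- c\<^sup>2 * (c ^ j + (c\<^sup>2) ^ Suc j) = of_int (rho (int j))" for j
  proof -
    have "- c\<^sup>2 * (c ^ j + (c\<^sup>2) ^ Suc j) = fps_const (- w\<^sup>2 * (w ^ j + w ^ (2 * Suc j)))"
      by (simp only: c_def power_mult fps_const_power fps_const_mult fps_const_neg fps_const_add)
    then show ?thesis
      by (simp only: rho_eq_cube_roots[OF w] fps_of_int)
  qed
  \<comment> \<open>One more term than \<open>n\<close>, because \<open>k = Suc j\<close> in
    \<open>?B\<close> pairs with \<open>k = j\<close> in \<open>?A\<close>; the surplus last term of
    \<open>?A\<close> vanishes modulo \<open>X ^ n\<close>.\<close>
  let ?N = "Suc n"
  let ?F = "\<Prod>i<?N. (1 + c * X * X ^ i) * (1 + c\<^sup>2 * X ^ i)"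
  let ?A = "(\<Sum>k\<le>?N. X ^ (k choose 2) * (c * X) ^ k)"
  let ?B = "(\<Sum>k=1..?N. X ^ (k choose 2) * (c\<^sup>2) ^ k)"
  have dvd: "X ^ n dvd X ^ ?N" by simp
  have "[qpoch X ?N * ?F = ?A + ?B] (modulo X ^ ?N)"
  proof (rule triple_product_cong)
    show "X ^ i \<noteq> 1" if "i > 0" for i
      using fps_X_power_power_neq_one[of 1 i] that by (simp add: X_def)
    show "c * X * c\<^sup>2 = X" using c3 by (simp add: mult_ac)
  qed (simp add: X_def)
  then have 1: "[qpoch X ?N * ?F = ?A + ?B] (modulo X ^ n)"
    by (rule ring_cong_dvd_modulus) (rule dvd)
  have A: "[?A = (\<Sum>j\<le>n. c ^ j * X ^ (Suc j choose 2))] (modulo X ^ n)"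
  proof -
    have "?A = (\<Sum>j\<le>n. c ^ j * X ^ (Suc j choose 2)) + c ^ ?N * X ^ (Suc ?N choose 2)"
      by (simp add: choose_two_Suc power_mult_distrib power_add mult_ac)
    moreover have "[c ^ ?N * X ^ (Suc ?N choose 2) = 0] (modulo X ^ n)"
      by (auto simp: ring_cong_def choose_two_Suc intro!: dvd_mult le_imp_power_dvd simp del: power_Suc)
    ultimately show ?thesis
      using ring_cong_add[OF ring_cong_refl] by fastforce
  qed
  have B: "?B = (\<Sum>j\<le>n. (c\<^sup>2) ^ Suc j * X ^ (Suc j choose 2))"
    by (rule sum.reindex_bij_witness[of _ Suc "\<lambda>k. k - 1"]) auto
  \<comment> \<open>The factors are paired with a shift: \<open>1 + c\<^sup>2 * X ^ 0\<close> is
    left at the bottom and gives \<open>- c\<close>, while \<open>1 + c * X ^ ?N\<close> is left at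
    the top and is congruent to 1.\<close>
  have F: "[?F = - c * (\<Prod>i<n. 1 - X ^ Suc i + (X ^ Suc i)\<^sup>2)] (modulo X ^ n)"
  proof -
    have "?F = (\<Prod>i<?N. 1 + c * X ^ Suc i) * (\<Prod>i<?N. 1 + c\<^sup>2 * X ^ i)"
      by (simp add: prod.distrib mult.assoc)
    also have "\<dots> = (1 + c * X ^ ?N) * ((1 + c\<^sup>2) * (\<Prod>i<n. (1 + c * X ^ Suc i) * (1 + c\<^sup>2 * X ^ Suc i)))"
      by (subst (2) prod.lessThan_Suc_shift) (simp add: prod.distrib mult_ac)
    also have "(1 + c\<^sup>2) = - c"
      using c by (simp add: add_eq_0_iff2 algebra_simps)
    also have "(\<Prod>i<n. (1 + c * X ^ Suc i) * (1 + c\<^sup>2 * X ^ Suc i)) = (\<Prod>i<n. 1 - X ^ Suc i + (X ^ Suc i)\<^sup>2)"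
    proof (intro prod.cong refl)
      fix i
      define x where "x = X ^ Suc i"
      have "(1 + c * x) * (1 + c\<^sup>2 * x) = 1 + (c\<^sup>2 + c + 1) * x - x + (c * c\<^sup>2) * x\<^sup>2"
        by (simp add: algebra_simps power2_eq_square)
      then show "(1 + c * X ^ Suc i) * (1 + c\<^sup>2 * X ^ Suc i) = 1 - X ^ Suc i + (X ^ Suc i)\<^sup>2"
        by (simp only: c c3 x_def) simp
    qed
    also have "[(1 + c * X ^ ?N) * (- c * (\<Prod>i<n. 1 - X ^ Suc i + (X ^ Suc i)\<^sup>2))
       = 1 * (- c * (\<Prod>i<n. 1 - X ^ Suc i + (X ^ Suc i)\<^sup>2))] (modulo X ^ n)"
      by (rule ring_cong_mult) (auto simp: ring_cong_def)
    finally show ?thesis by simp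
  qed
  have "(\<Sum>j\<le>n. of_int (rho (int j)) * X ^ (Suc j choose 2))
      = - c\<^sup>2 * ((\<Sum>j\<le>n. c ^ j * X ^ (Suc j choose 2)) + ?B)"
    unfolding B sum.distrib[symmetric] distrib_right[symmetric] sum_distrib_left
      mult.assoc[symmetric] c_pow ..
  also have "[\<dots> = - c\<^sup>2 * (?A + ?B)] (modulo X ^ n)"
    by (intro ring_cong_mult ring_cong_add ring_cong_sym[OF A] ring_cong_refl)
  also have "[\<dots> = - c\<^sup>2 * (qpoch X ?N * ?F)] (modulo X ^ n)"
    by (rule ring_cong_mult[OF ring_cong_refl ring_cong_sym[OF 1]])
  also have "[\<dots> = - c\<^sup>2 * (qpoch X n * (- c * (\<Prod>i<n. 1 - X ^ Suc i + (X ^ Suc i)\<^sup>2)))] (modulo X ^ n)"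
    by (rule ring_cong_mult[OF ring_cong_refl ring_cong_mult[OF qpoch_cong F]]) simp
  also have "\<dots> = (c * c\<^sup>2) * (qpoch X n * (\<Prod>i<n. 1 - X ^ Suc i + (X ^ Suc i)\<^sup>2))"
    by (simp only: mult_ac mult_minus_left mult_minus_right minus_minus)
  finally show ?thesis by (simp add: c3)
qed

lemma sum_atMost_plus_neg:
  fixes f :: "int \<Rightarrow> 'a::comm_monoid_add"
  shows "(\<Sum>k\<le>n. f (int k)) + (\<Sum>k=1..n. f (- int k)) = (\<Sum>k\<in>{-int n..int n}. f k)"
proof -
  have "{-int n..int n} = int ` {..n} \<union> (\<lambda>k. - int k) ` {1..n}"
  proof (intro equalityI subsetI)
    fix k assume k: "k \<in> {-int n..int n}"
    show "k \<in> int ` {..n} \<union> (\<lambda>k. - int k) ` {1..n}"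
    proof (cases "k \<ge> 0")
      case True
      then have "k = int (nat k)" "nat k \<in> {..n}" using k by auto
      then show ?thesis by blast
    next
      case False
      then have "k = - int (nat (- k))" "nat (- k) \<in> {1..n}" using k by auto
      then show ?thesis by blast
    qed
  qed auto
  also have "sum f \<dots> = sum f (int ` {..n}) + sum f ((\<lambda>k. - int k) ` {1..n})"
    by (rule sum.union_disjoint) auto
  also have "sum f (int ` {..n}) = (\<Sum>k\<le>n. f (int k))"
    by (simp add: sum.reindex)
  also have "sum f ((\<lambda>k. - int k) ` {1..n}) = (\<Sum>k=1..n. f (- int k))"
    by (subst sum.reindex) (auto intro: inj_onI)
  finally show ?thesis by simp
qed

text \<open>The triple product with \<open>Q = X ^ 6\<close>, \<open>a = - X\<close> and
  \<open>b = - (X ^ 5)\<close>. The exponents \<open>6 * (k choose 2) + k\<close> and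
  \<open>6 * (k choose 2) + 5 * k\<close> are the values of \<open>k * (3 * k - 2)\<close> at
  \<open>k\<close> and at \<open>- k\<close>.\<close>

lemma octagonal_theta_cong:
  fixes X :: "'a::field fps"
  defines "X \<equiv> fps_X"
  shows "[qpoch (X ^ 6) n * (\<Prod>i<n. (1 - X ^ (6 * i + 1)) * (1 - X ^ (6 * i + 5)))
      = (\<Sum>k\<in>{-int n..int n}. (-1) ^ nat \<bar>k\<bar> * X ^ nat (k * (3 * k - 2)))] (modulo X ^ n)"
proof -
  have "[qpoch (X ^ 6) n * (\<Prod>i<n. (1 + (- X) * (X ^ 6) ^ i) * (1 + (- (X ^ 5)) * (X ^ 6) ^ i))
      = (\<Sum>k\<le>n. (X ^ 6) ^ (k choose 2) * (- X) ^ k)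
        + (\<Sum>k=1..n. (X ^ 6) ^ (k choose 2) * (- (X ^ 5)) ^ k)] (modulo (X ^ 6) ^ n)"
  proof (rule triple_product_cong)
    show "(X ^ 6) ^ i \<noteq> 1" if "i > 0" for i
      using fps_X_power_power_neq_one[of 6 i] that by (simp add: X_def)
    show "(- X) * (- (X ^ 5)) = X ^ 6"
      by (simp flip: power_Suc)
  qed (simp add: X_def)
  then have "[qpoch (X ^ 6) n * (\<Prod>i<n. (1 + (- X) * (X ^ 6) ^ i) * (1 + (- (X ^ 5)) * (X ^ 6) ^ i))
      = (\<Sum>k\<le>n. (X ^ 6) ^ (k choose 2) * (- X) ^ k)
        + (\<Sum>k=1..n. (X ^ 6) ^ (k choose 2) * (- (X ^ 5)) ^ k)] (modulo X ^ n)"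
  proof (rule ring_cong_dvd_modulus)
    show "X ^ n dvd (X ^ 6) ^ n"
      unfolding power_mult[symmetric] by (rule le_imp_power_dvd) simp
  qed
  also have "(\<Prod>i<n. (1 + (- X) * (X ^ 6) ^ i) * (1 + (- (X ^ 5)) * (X ^ 6) ^ i))
      = (\<Prod>i<n. (1 - X ^ (6 * i + 1)) * (1 - X ^ (6 * i + 5)))"
    by (simp only: power_add power_mult) (simp add: mult_ac)
  also have "(\<Sum>k\<le>n. (X ^ 6) ^ (k choose 2) * (- X) ^ k)
      = (\<Sum>k\<le>n. (-1) ^ nat \<bar>int k\<bar> * X ^ nat (int k * (3 * int k - 2)))"
  proof (intro sum.cong refl)
    fix k
    have "2 * int (k choose 2) + int k = int k * int k"
      using choose_two_double[of k] by (metis of_nat_add of_nat_mult of_nat_numeral)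
    then have "nat (int k * (3 * int k - 2)) = 6 * (k choose 2) + k"
      by (simp add: algebra_simps)
    then show "(X ^ 6) ^ (k choose 2) * (- X) ^ k
        = (-1) ^ nat \<bar>int k\<bar> * X ^ nat (int k * (3 * int k - 2))"
      by (simp add: power_add power_mult power_minus[of X] mult_ac)
  qed
  also have "(\<Sum>k=1..n. (X ^ 6) ^ (k choose 2) * (- (X ^ 5)) ^ k)
      = (\<Sum>k=1..n. (-1) ^ nat \<bar>- int k\<bar> * X ^ nat (- int k * (3 * (- int k) - 2)))"
  proof (intro sum.cong refl)
    fix k
    have "2 * int (k choose 2) + int k = int k * int k"
      using choose_two_double[of k] by (metis of_nat_add of_nat_mult of_nat_numeral)
    then have e: "nat (- int k * (3 * (- int k) - 2)) = 6 * (k choose 2) + 5 * k"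
      by (simp add: algebra_simps)
    show "(X ^ 6) ^ (k choose 2) * (- (X ^ 5)) ^ k
        = (-1) ^ nat \<bar>- int k\<bar> * X ^ nat (- int k * (3 * (- int k) - 2))"
      unfolding e power_add power_mult power_minus[of "X ^ 5"] by (simp add: mult.left_commute)
  qed
  finally show ?thesis
    by (simp only: sum_atMost_plus_neg[where f = "\<lambda>k. (-1) ^ nat \<bar>k\<bar> * X ^ nat (k * (3 * k - 2))"])
qed

section \<open>Assembling the identity and comparing coefficients\<close>

lemma b6_theta_cong:
  fixes X :: "complex fps"
  defines "X \<equiv> fps_X"
  shows "[(\<Sum>j\<le>n. of_int (rho (int j)) * X ^ (Suc j choose 2)) * Abs_fps (\<lambda>m. of_nat (b6 (int m)))
      = (\<Sum>k\<in>{-int n..int n}. (-1) ^ nat \<bar>k\<bar> * X ^ nat (k * (3 * k - 2)))] (modulo X ^ n)"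
    (is "[?S * ?B = ?T] (modulo _)")
proof -
  let ?R = "\<Prod>i<n. 1 - X ^ Suc i + (X ^ Suc i)\<^sup>2"
  let ?D = "\<Prod>i<n. (1 - X ^ (6 * i + 1)) * (1 - X ^ (6 * i + 5))"
  have "[?S * ?B = (qpoch X n * ?R) * ?B] (modulo X ^ n)"
    unfolding X_def by (intro ring_cong_mult rho_theta_cong ring_cong_refl)
  also have "(qpoch X n * ?R) * ?B = (?B * qpoch X n) * ?R"
    by (simp only: mult_ac)
  also have "[\<dots> = qpoch (X ^ 6) n * ?D] (modulo X ^ n)"
    unfolding X_def by (intro ring_cong_mult regular_partition_gf_cong cyclotomic_product_cong) simp
  also have "[\<dots> = ?T] (modulo X ^ n)"
    unfolding X_def by (rule octagonal_theta_cong)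
  finally show ?thesis .
qed

text \<open>The cofactor of \<open>k - l\<close> is congruent to 1 modulo 3, hence nonzero. So at
  most one \<open>k\<close> contributes to a given coefficient.\<close>

lemma octagonal_inj:
  fixes k l :: int
  assumes "k * (3 * k - 2) = l * (3 * l - 2)"
  shows "k = l"
proof -
  have "(k - l) * (3 * (k + l) - 2) = 0"
    using assms by (simp add: algebra_simps)
  moreover have "3 * (k + l) - 2 \<noteq> 0" by presburger
  ultimately show ?thesis by simp
qed

text \<open>This makes the exponents nonnegative, so that \<open>nat\<close> loses nothing, and
  confines every \<open>k\<close> with value \<open>n\<close> to the finite summation range.\<close>

lemma octagonal_ge_abs: "\<bar>k\<bar> \<le> k * (3 * k - 2)" for k :: int
proof (cases "k \<ge> 1")
  case True
  then have "k * 1 \<le> k * (3 * k - 2)" by (intro mult_left_mono) auto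
  with True show ?thesis by simp
next
  case False
  then have "(- k) * 1 \<le> (- k) * (2 - 3 * k)" by (intro mult_left_mono) auto
  with False show ?thesis by (simp add: algebra_simps)
qed

lemma b6_recurrence:
  "(\<Sum>j\<le>Suc n. real_of_int (rho (int j)) * real (b6 (int n - int j * (int j + 1) div 2)))
    = (\<Sum>k\<in>{-int (Suc n)..int (Suc n)}. if int n = k * (3 * k - 2) then (-1) ^ nat \<bar>k\<bar> else 0)"
    (is "?l = ?r")
proof -
  have tri: "int j * (int j + 1) div 2 = int (Suc j choose 2)" for j
    using arg_cong[OF choose_two_double[of "Suc j"], of int]
    by (simp add: algebra_simps)
  have oct: "nat (k * (3 * k - 2)) = n \<longleftrightarrow> int n = k * (3 * k - 2)" for k
    using octagonal_ge_abs[of k] by auto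
  have "complex_of_real ?l = ((\<Sum>j\<le>Suc n. of_int (rho (int j)) * fps_X ^ (Suc j choose 2))
      * Abs_fps (\<lambda>m. of_nat (b6 (int m)))) $ n"
    unfolding sum_distrib_right fps_sum_nth of_real_sum
  proof (intro sum.cong refl)
    fix j
    have 1: "complex_of_real (real_of_int (rho (int j)) * real (b6 (int n - int j * (int j + 1) div 2)))
       = of_int (rho (int j)) * (if n < (Suc j choose 2) then 0 else of_nat (b6 (int (n - (Suc j choose 2)))))"
      unfolding tri by (auto simp: num_regular_partitions_def of_nat_diff)
    have 2: "(of_int (rho (int j)) * fps_X ^ (Suc j choose 2) * Abs_fps (\<lambda>m. of_nat (b6 (int m)))) $ n
       = of_int (rho (int j)) * (fps_X ^ (Suc j choose 2) * Abs_fps (\<lambda>m. complex_of_nat (b6 (int m)))) $ n"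
      by (simp only: mult.assoc fps_of_int[symmetric] fps_mult_left_const_nth)
    show "complex_of_real (real_of_int (rho (int j)) * real (b6 (int n - int j * (int j + 1) div 2)))
       = (of_int (rho (int j)) * fps_X ^ (Suc j choose 2) * Abs_fps (\<lambda>m. of_nat (b6 (int m)))) $ n"
      unfolding 1 2 by (simp add: fps_X_power_mult_nth)
  qed
  \<comment> \<open>The modulus is \<open>fps_X ^ Suc n\<close>, the least power whose congruence
    still determines coefficient \<open>n\<close>.\<close>
  also have "\<dots> = (\<Sum>k\<in>{-int (Suc n)..int (Suc n)}. (-1) ^ nat \<bar>k\<bar> * fps_X ^ nat (k * (3 * k - 2))) $ n"
    using b6_theta_cong[of "Suc n"] unfolding ring_cong_fps_X_power by blast
  also have "\<dots> = complex_of_real ?r"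
    unfolding fps_sum_nth of_real_sum
  proof (intro sum.cong refl)
    fix k :: int
    have "(-1 :: complex fps) ^ m = fps_const ((-1) ^ m)" for m
      by (simp flip: fps_const_power fps_const_neg)
    then show "((-1) ^ nat \<bar>k\<bar> * fps_X ^ nat (k * (3 * k - 2)) :: complex fps) $ n
        = complex_of_real (if int n = k * (3 * k - 2) then (-1) ^ nat \<bar>k\<bar> else 0)"
      using oct[of k] by auto
  qed
  finally show ?thesis by (simp only: of_real_eq_iff)
qed

theorem theorem1p10:
  fixes n :: int
  assumes "n \<ge> 0"
  shows "(\<forall>k::int. n = k * (3 * k - 2) \<longrightarrow> (\<lambda>j::nat. real_of_int (rho (int j)) * real (b6 (n - int j * (int j + 1) div 2))) sums ((-1) powi k)) \<and>
         ((\<nexists>k::int. n = k * (3 * k - 2)) \<longrightarrow> (\<lambda>j::nat. real_of_int (rho (int j)) * real (b6 (n - int j * (int j + 1) div 2))) sums 0)"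
proof -
  let ?f = "\<lambda>j::nat. real_of_int (rho (int j)) * real (b6 (n - int j * (int j + 1) div 2))"
  let ?K = "{-int (Suc (nat n))..int (Suc (nat n))}"
  \<comment> \<open>The triangular number is at least \<open>j > n\<close>, so \<open>b6\<close>
    gets a negative argument and takes its default value 0; the series is a finite sum.\<close>
  have "?f j = 0" if "j \<notin> {..Suc (nat n)}" for j
  proof -
    have "n + 1 < int j" using that assms by simp
    moreover have "2 * int j \<le> (int j + 1) * int j" using that by (intro mult_right_mono) auto
    ultimately have "n < int j * (int j + 1) div 2" by (simp add: algebra_simps)
    then show ?thesis by (simp add: num_regular_partitions_def)
  qed
  then have "?f sums (\<Sum>j\<le>Suc (nat n). ?f j)"
    by (intro sums_finite) auto
  also have "(\<Sum>j\<le>Suc (nat n). ?f j) = (\<Sum>k\<in>?K. if n = k * (3 * k - 2) then (-1) ^ nat \<bar>k\<bar> else 0)"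
    using b6_recurrence[of "nat n"] assms by simp
  finally have sums: "?f sums \<dots>" .
  show ?thesis
  proof (intro conjI allI impI)
    fix k :: int assume k: "n = k * (3 * k - 2)"
    have "n = l * (3 * l - 2) \<longleftrightarrow> l = k" for l
      using k octagonal_inj[of k l] by auto
    moreover have "k \<in> ?K"
      using octagonal_ge_abs[of k] k by auto
    moreover have "(-1) powi k = ((-1) ^ nat \<bar>k\<bar> :: real)"
      by (auto simp: power_int_def)
    ultimately show "?f sums ((-1) powi k)"
      using sums by simp
  next
    assume "\<nexists>k. n = k * (3 * k - 2)"
    then show "?f sums 0" using sums by simp
  qed
qed

end
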